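(* Let $j\in\{0,\tfrac12,1,\tfrac32,\dots\}$ and let $T_1,T_2,T_3,T_4$ be complex $(2j+1)\times(2j+1)$ matrices satisfying the relations of the four-dimensional Euclidean Nambu--Lie 3-algebra $\mathcal{A}_4$, $$[T_a,T_b,T_c]_N=\mathrm{i}\sum_{d=1}^4\epsilon_{abcd}T_d,\qquad a,b,c\in\{1,2,3,4\}.$$ Suppose that $T_4=t_4\,\mathbb{I}$ for some nonzero complex number $t_4$, and that the matrices $T_1,T_2,T_3$ act irreducibly on $\mathbb{C}^{2j+1}$. Then $$t_4^4=-j(j+1).$$ In particular, the matrices $T_1,T_2,T_3,T_4$ cannot all be Hermitian.
   Context: For square complex matrices $A,B,C$ of the same size, the Nambu commutator is $$[A,B,C]_N=ABC+BCA+CAB-BAC-ACB-CBA.$$ $\epsilon_{abcd}$ is the totally antisymmetric symbol with $\epsilon_{1234}=+1$, $\mathbb{I}$ is the identity matrix and $\mathrm{i}$ is the imaginary unit. "Act irreducibly" means that the only subspaces of $\mathbb{C}^{2j+1}$ invariant under all of $T_1,T_2,T_3$ are $0$ and the whole space. *)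

theory Defs
  imports "HOL-Analysis.Analysis"
begin

definition smult_matrix :: "complex \<Rightarrow> complex^'n^'n \<Rightarrow> complex^'n^'n"  (infixr \<open>*\<^sub>m\<close> 75)
  where "c *\<^sub>m A = (\<chi> r s. c * A $ r $ s)"

definition nambu_commutator ::
    "complex^'n^'n \<Rightarrow> complex^'n^'n \<Rightarrow> complex^'n^'n \<Rightarrow> complex^'n^'n"
  where "nambu_commutator A B C =
    A ** B ** C + B ** C ** A + C ** A ** B - B ** A ** C - A ** C ** B - C ** B ** A"

text \<open>
  The sign of the Vandermonde product counts inversions, so on the indices 1, 2, 3, 4 this is the
  totally antisymmetric symbol; the two lemmas below verify its defining properties
  (antisymmetry under adjacent transpositions and the normalisation).
\<close>
definition levi_civita4 :: "nat \<Rightarrow> nat \<Rightarrow> nat \<Rightarrow> nat \<Rightarrow> int"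
  where "levi_civita4 a b c d =
    sgn ((int b - int a) * (int c - int a) * (int d - int a) *
         (int c - int b) * (int d - int b) * (int d - int c))"

lemma levi_civita4_1234: "levi_civita4 1 2 3 4 = 1"
  by (simp add: levi_civita4_def)

lemma levi_civita4_antisym:
  "levi_civita4 b a c d = - levi_civita4 a b c d"
  "levi_civita4 a c b d = - levi_civita4 a b c d"
  "levi_civita4 a b d c = - levi_civita4 a b c d"
proof -
  have flip: "sgn (int y - int x) = - sgn (int x - int y)" for x y
    by (simp add: sgn_if)
  show "levi_civita4 b a c d = - levi_civita4 a b c d"
    using flip[of a b] by (simp add: levi_civita4_def sgn_mult)
  show "levi_civita4 a c b d = - levi_civita4 a b c d"
    using flip[of b c] by (simp add: levi_civita4_def sgn_mult)
  show "levi_civita4 a b d c = - levi_civita4 a b c d"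
    using flip[of c d] by (simp add: levi_civita4_def sgn_mult)
qed

definition nambu_A4_relations :: "(nat \<Rightarrow> complex^'n^'n) \<Rightarrow> bool"
  where "nambu_A4_relations T \<longleftrightarrow>
    (\<forall>a\<in>{1..4}. \<forall>b\<in>{1..4}. \<forall>c\<in>{1..4}.
      nambu_commutator (T a) (T b) (T c) =
        \<i> *\<^sub>m (\<Sum>d=1..4. of_int (levi_civita4 a b c d) *\<^sub>m T d))"

text \<open>
  Here \<open>vec.subspace\<close> is closed under complex scalars, whereas plain \<open>subspace\<close> would mean a real
  subspace.
\<close>
definition acts_irreducibly :: "(complex^'n^'n) set \<Rightarrow> bool"
  where "acts_irreducibly S \<longleftrightarrow>
    (\<forall>W. vec.subspace W \<and> (\<forall>A\<in>S. \<forall>v\<in>W. A *v v \<in> W) \<longrightarrow> W = {0} \<or> W = UNIV)"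

definition hermitian_matrix :: "complex^'n^'n \<Rightarrow> bool"
  where "hermitian_matrix A \<longleftrightarrow> (\<chi> r s. cnj (A $ s $ r)) = A"

end

theory Submission
  imports Defs "HOL-Computational_Algebra.Fundamental_Theorem_Algebra"
begin

text \<open>
  With \<open>T\<^sub>4 = t\<^sub>4 \<I>\<close>, the relations involving \<open>T\<^sub>4\<close> say that \<open>S\<^sub>a = - t\<^sub>4 T\<^sub>a\<close> satisfy
  \<open>[S\<^sub>1, S\<^sub>2] = \<i> S\<^sub>3\<close> and its cyclic permutations, and the relation for
  \<open>[T\<^sub>1, T\<^sub>2, T\<^sub>3]\<close> then says that the Casimir operator \<open>S\<^sub>1\<^sup>2 + S\<^sub>2\<^sup>2 + S\<^sub>3\<^sup>2\<close> is the scalar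
  \<open>- t\<^sub>4\<^sup>4\<close>.  A vector of highest weight \<open>m\<close> and its images under the lowering operator span a
  nonzero invariant subspace, hence everything, so the chain has exactly \<open>2j + 1\<close> members.
  Evaluating the Casimir operator at both ends of the chain gives \<open>m = j\<close> and the value
  \<open>j(j + 1)\<close>.  If \<open>T\<^sub>4\<close> were Hermitian, \<open>t\<^sub>4\<close> would be real and nonzero, but
  \<open>t\<^sub>4\<^sup>4 = - j(j + 1) \<le> 0\<close>.
\<close>

section \<open>Existence of eigenvectors\<close>

lemma independent_if_successively_notin_span:
  fixes f :: "nat \<Rightarrow> complex^'n"
  assumes "\<And>i. i < n \<Longrightarrow> f i \<notin> vec.span (f ` {..<i})"
  shows "vec.independent (f ` {..<n}) \<and> card (f ` {..<n}) = n"
  using assms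
proof (induction n)
  case 0
  then show ?case by (simp add: vec.independent_empty)
next
  case (Suc n)
  have n: "f n \<notin> vec.span (f ` {..<n})"
    using Suc.prems by simp
  then have "f n \<notin> f ` {..<n}"
    by (metis vec.span_base)
  moreover have "vec.independent (f ` {..<n}) \<and> card (f ` {..<n}) = n"
    using Suc by simp
  ultimately show ?case
    using n by (simp add: lessThan_Suc vec.independent_insertI)
qed

text \<open>This is the vector \<open>p(H) x\<close>, computed by Horner's rule directly on vectors,
  so that no ring of endomorphisms has to be set up.\<close>

definition poly_operator :: "(complex^'n \<Rightarrow> complex^'n) \<Rightarrow> complex^'n \<Rightarrow> complex poly \<Rightarrow> complex^'n"
  where "poly_operator H x p = fold_coeffs (\<lambda>a w. a *s x + H w) p 0"

context
  fixes H :: "complex^'n \<Rightarrow> complex^'n"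
  assumes linear_H: "Vector_Spaces.linear (*s) (*s) H"
begin

lemmas H_simps = vec.linear_add[OF linear_H] vec.linear_scale[OF linear_H]
  vec.linear_0[OF linear_H] vec.linear_diff[OF linear_H] vec.linear_neg[OF linear_H]

lemma poly_operator_0 [simp]: "poly_operator H x 0 = 0"
  by (simp add: poly_operator_def)

lemma poly_operator_pCons: "poly_operator H x (pCons a p) = a *s x + H (poly_operator H x p)"
  \<comment> \<open>\<open>pCons 0 0\<close> collapses to \<open>0\<close>, so the Horner step does
    not unfold there; that case rests on \<open>H 0 = 0\<close>.\<close>
  by (cases "a = 0 \<and> p = 0") (auto simp: poly_operator_def H_simps)

lemma poly_operator_add: "poly_operator H x (p + q) = poly_operator H x p + poly_operator H x q"
  by (induction p q rule: poly_induct2)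
    (simp_all add: poly_operator_pCons H_simps vec.scale_left_distrib add.assoc add.left_commute)

lemma poly_operator_smult: "poly_operator H x (smult c p) = c *s poly_operator H x p"
  by (induction p) (simp_all add: poly_operator_pCons H_simps vec.scale_right_distrib)

lemma poly_operator_monom: "poly_operator H x (monom 1 n) = (H ^^ n) x"
  by (induction n) (simp_all add: poly_operator_pCons H_simps monom_Suc monom_0)

text \<open>In finite dimension some iterate \<open>H^n x\<close> depends linearly on the earlier
  ones, and that dependence is a monic polynomial relation.\<close>

lemma annihilating_polynomial_exists: "\<exists>p. p \<noteq> 0 \<and> poly_operator H x p = 0"
proof -
  define f where "f i = (H ^^ i) x" for i
  have "\<exists>n. f n \<in> vec.span (f ` {..<n})"
  proof (rule ccontr)
    assume "\<not> ?thesis"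
    then have "f i \<notin> vec.span (f ` {..<i})" for i
      by simp
    then have "vec.independent (f ` {..<Suc CARD('n)}) \<and> card (f ` {..<Suc CARD('n)}) = Suc CARD('n)"
      by (rule independent_if_successively_notin_span)
    then show False
      using vec.independent_card_le_dim[of "f ` {..<Suc CARD('n)}" UNIV]
      by (simp add: vec_dim_card del: vec.dim_UNIV)
  qed
  then obtain n where n: "f n \<in> vec.span (f ` {..<n})" by blast
  \<comment> \<open>The vectors \<open>q(H) x\<close> with \<open>q\<close> of degree below
    \<open>n\<close>. Bounding coefficients instead of the degree also covers \<open>n = 0\<close>,
    where only \<open>q = 0\<close> remains.\<close>
  define W where "W = {poly_operator H x q | q. \<forall>i\<ge>n. coeff q i = 0}"
  have "vec.subspace W"
    unfolding vec.subspace_def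
  proof (intro conjI ballI allI)
    show "0 \<in> W"
      unfolding W_def by (auto intro!: exI[of _ 0])
  next
    fix u v assume "u \<in> W" "v \<in> W"
    then obtain p q where "u = poly_operator H x p" "v = poly_operator H x q"
      "\<forall>i\<ge>n. coeff p i = 0" "\<forall>i\<ge>n. coeff q i = 0" unfolding W_def by blast
    then show "u + v \<in> W"
      unfolding W_def by (auto simp: poly_operator_add intro!: exI[of _ "p + q"])
  next
    fix c u assume "u \<in> W"
    then obtain p where "u = poly_operator H x p" "\<forall>i\<ge>n. coeff p i = 0" unfolding W_def by blast
    then show "c *s u \<in> W"
      unfolding W_def by (auto simp: poly_operator_smult intro!: exI[of _ "smult c p"])
  qed
  moreover have "f ` {..<n} \<subseteq> W"
  proof clarify
    fix i assume "i < n"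
    then show "f i \<in> W"
      unfolding W_def f_def by (auto simp: poly_operator_monom intro!: exI[of _ "monom 1 i"])
  qed
  ultimately have "f n \<in> W"
    using n vec.span_minimal by blast
  then obtain q where q: "f n = poly_operator H x q" "\<forall>i\<ge>n. coeff q i = 0"
    unfolding W_def by blast
  let ?p = "monom 1 n + smult (- 1) q"
  have "coeff ?p n = 1"
    using q by simp
  then have "?p \<noteq> 0" by (metis coeff_0 zero_neq_one)
  moreover have "poly_operator H x ?p = 0"
    unfolding poly_operator_add poly_operator_smult poly_operator_monom by (simp add: q(1)[symmetric] f_def)
  ultimately show ?thesis by blast
qed

text \<open>Take \<open>p\<close> of least degree with \<open>p(H) x = 0\<close> and split off a
  root, \<open>p = (X - z) q\<close>. By minimality \<open>q(H) x\<close> is nonzero, and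
  \<open>H - z\<close> kills it.\<close>

lemma eigenvector_exists: "\<exists>v m. v \<noteq> 0 \<and> H v = m *s v"
proof -
  define x :: "complex^'n" where "x = 1"
  have x: "x \<noteq> 0" by (simp add: x_def)
  obtain p where p: "p \<noteq> 0" "poly_operator H x p = 0"
    and least: "\<And>q. q \<noteq> 0 \<Longrightarrow> poly_operator H x q = 0 \<Longrightarrow> degree p \<le> degree q"
    using annihilating_polynomial_exists[of x] ex_has_least_nat[of "\<lambda>p. p \<noteq> 0 \<and> poly_operator H x p = 0" _ degree]
    by metis
  have "degree p \<noteq> 0"
  proof
    assume "degree p = 0"
    then obtain a where "p = [:a:]" by (rule degree_eq_zeroE)
    with p x show False by (simp add: poly_operator_pCons H_simps)
  qed
  then obtain z where "poly p z = 0"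
    using fundamental_theorem_of_algebra[of p] by (auto simp: constant_degree)
  then obtain q where q: "p = [:- z, 1:] * q"
    by (metis poly_eq_0_iff_dvd dvdE)
  with p have "q \<noteq> 0" by auto
  then have "degree q < degree p"
    unfolding q by (subst degree_mult_eq) auto
  then have "poly_operator H x q \<noteq> 0"
    using least \<open>q \<noteq> 0\<close> by force
  moreover have "H (poly_operator H x q) = z *s poly_operator H x q"
  proof -
    have "p = smult (- z) q + pCons 0 q"
      using q by simp
    then have "poly_operator H x p = - z *s poly_operator H x q + H (poly_operator H x q)"
      by (simp only: poly_operator_add poly_operator_smult poly_operator_pCons) simp
    with p(2) show ?thesis
      by simp
  qed
  ultimately show ?thesis by blast
qed

section \<open>Ladder operators\<close>

text \<open>\<open>[H, X] = d X\<close>, so each application of \<open>X\<close> shifts an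
  \<open>H\<close>-eigenvalue by \<open>d\<close>.\<close>

lemma funpow_ladder:
  assumes X: "Vector_Spaces.linear (*s) (*s) X"
    and comm: "\<And>v. H (X v) = X (H v) + d *s X v"
    and v: "H v = m *s v"
  shows "H ((X ^^ k) v) = (m + of_nat k * d) *s (X ^^ k) v"
proof (induction k)
  case 0
  then show ?case by (simp add: v)
next
  case (Suc k)
  have "H ((X ^^ Suc k) v) = (m + of_nat k * d) *s X ((X ^^ k) v) + d *s X ((X ^^ k) v)"
    by (simp only: funpow.simps o_apply comm Suc vec.linear_scale[OF X])
  also have "\<dots> = (m + of_nat (Suc k) * d) *s (X ^^ Suc k) v"
    by (simp add: vec_eq_iff algebra_simps)
  finally show ?case .
qed

text \<open>The eigenvalues along a ladder are unbounded, whereas those of \<open>H\<close> are bounded by its operator norm.\<close>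
lemma funpow_ladder_vanishes:
  assumes X: "Vector_Spaces.linear (*s) (*s) X"
    and comm: "\<And>v. H (X v) = X (H v) + d *s X v"
    and v: "H v = m *s v" and d: "d \<noteq> 0"
  shows "\<exists>k. (X ^^ k) v = 0"
proof (rule ccontr)
  assume nz: "\<not> ?thesis"
  \<comment> \<open>The boundedness theorem concerns real-linear maps, so real scaling is first
    identified with \<open>*s\<close>.\<close>
  have scaleR_eq_scale: "r *\<^sub>R w = complex_of_real r *s w" for r and w :: "complex^'n"
    by (simp add: vec_eq_iff, simp add: scaleR_conv_of_real)
  have "linear H"
    by (rule linearI) (simp_all add: H_simps scaleR_eq_scale)
  then obtain B where B: "\<And>w. norm (H w) \<le> B * norm w"
    using linear_bounded by blast
  have norm_scale: "norm (c *s w) = cmod c * norm w" for c and w :: "complex^'n"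
    by (simp add: norm_vec_def norm_mult L2_set_right_distrib)
  have bound: "cmod (m + of_nat k * d) \<le> B" for k
    using B[of "(X ^^ k) v"] nz
    unfolding funpow_ladder[OF X comm v] norm_scale by simp
  obtain k :: nat where k: "real k * cmod d > B + cmod m"
    using reals_Archimedean3[of "cmod d"] d by auto
  have "real k * cmod d \<le> cmod (m + of_nat k * d) + cmod m"
    using norm_triangle_ineq4[of "m + of_nat k * d" m] by (simp add: norm_mult)
  with bound[of k] k show False by linarith
qed
end

section \<open>Invariant spans and nilpotent chains\<close>

lemma linear_image_span_subset:
  fixes X :: "complex^'n \<Rightarrow> complex^'n"
  assumes X: "Vector_Spaces.linear (*s) (*s) X"
    and "\<And>b. b \<in> B \<Longrightarrow> X b \<in> vec.span B" and "w \<in> vec.span B"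
  shows "X w \<in> vec.span B"
proof -
  have "vec.subspace {w. X w \<in> vec.span B}"
    by (auto simp: vec.subspace_def vec.linear_0[OF X] vec.linear_add[OF X] vec.linear_scale[OF X]
        vec.span_zero vec.span_add vec.span_scale)
  moreover have "B \<subseteq> {w. X w \<in> vec.span B}"
    using assms(2) by auto
  ultimately have "vec.span B \<subseteq> {w. X w \<in> vec.span B}"
    by (rule vec.span_minimal[rotated])
  with assms(3) show ?thesis
    by auto
qed

lemma linear_funpow:
  fixes X :: "complex^'n \<Rightarrow> complex^'n"
  assumes X: "Vector_Spaces.linear (*s) (*s) X"
  shows "Vector_Spaces.linear (*s) (*s) (X ^^ k)"
proof (induction k)
  case 0
  show ?case
    unfolding funpow.simps by (rule vec.linear_id)
next
  case (Suc k)
  then show ?case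
    unfolding funpow.simps using X by (rule Vector_Spaces.linear_compose)
qed

text \<open>As \<open>v\<close> is nonzero, the least vanishing exponent is positive;
  \<open>k\<close> is its predecessor, the index of the last nonzero vector.\<close>

lemma least_funpow_vanishing:
  fixes X :: "'a::zero \<Rightarrow> 'a"
  assumes "\<exists>k. (X ^^ k) v = 0" and "v \<noteq> 0"
  obtains k where "(X ^^ Suc k) v = 0" "\<And>i. i \<le> k \<Longrightarrow> (X ^^ i) v \<noteq> 0"
proof -
  define n where "n = (LEAST k. (X ^^ k) v = 0)"
  have n: "(X ^^ n) v = 0"
    unfolding n_def by (rule LeastI_ex[OF assms(1)])
  have "n \<noteq> 0"
    using n assms(2) by (cases "n = 0") simp_all
  then obtain k where k: "n = Suc k"
    using not0_implies_Suc by blast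
  show thesis
  proof (rule that)
    show "(X ^^ Suc k) v = 0"
      using n unfolding k .
    show "(X ^^ i) v \<noteq> 0" if "i \<le> k" for i
      using that k unfolding n_def by (intro not_less_Least) simp
  qed
qed

text \<open>Read the chain backwards from its last nonzero vector: \<open>F^i\<close> kills every
  \<open>g l\<close> with \<open>l < i\<close> but sends \<open>g i\<close> to \<open>F^k u\<close>,
  which is nonzero. Hence no \<open>g i\<close> lies in the span of its predecessors.\<close>

lemma dim_nilpotent_orbit:
  fixes F :: "complex^'n \<Rightarrow> complex^'n"
  assumes F: "Vector_Spaces.linear (*s) (*s) F"
    and zero: "(F ^^ Suc k) u = 0" and nz: "(F ^^ k) u \<noteq> 0"
  shows "vec.dim ((\<lambda>i. (F ^^ i) u) ` {..k}) = Suc k"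
proof -
  define g where "g i = (F ^^ (k - i)) u" for i
  have later: "(F ^^ i) u = 0" if "i > k" for i
  proof -
    have "(F ^^ i) u = (F ^^ (i - Suc k + Suc k)) u"
      using that by simp
    also have "\<dots> = (F ^^ (i - Suc k)) ((F ^^ Suc k) u)"
      by (simp only: funpow_add o_apply)
    finally have "(F ^^ i) u = (F ^^ (i - Suc k)) ((F ^^ Suc k) u)" .
    then show ?thesis
      unfolding zero by (simp add: vec.linear_0[OF linear_funpow[OF F]])
  qed
  have "g i \<notin> vec.span (g ` {..<i})" if i: "i < Suc k" for i
  proof
    assume "g i \<in> vec.span (g ` {..<i})"
    moreover have "vec.subspace {w. (F ^^ i) w = 0}"
      using linear_funpow[OF F] by (auto simp: vec.subspace_def vec.linear_0 vec.linear_add vec.linear_scale)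
    moreover have "g ` {..<i} \<subseteq> {w. (F ^^ i) w = 0}"
    proof clarify
      fix l assume "l < i"
      have "(F ^^ i) (g l) = (F ^^ (i + (k - l))) u"
        by (simp add: g_def funpow_add)
      then show "(F ^^ i) (g l) = 0"
        using later i \<open>l < i\<close> by simp
    qed
    ultimately have "(F ^^ i) (g i) = 0"
      using vec.span_minimal by blast
    moreover have "(F ^^ i) (g i) = (F ^^ (i + (k - i))) u"
      by (simp add: g_def funpow_add)
    ultimately show False
      using nz i by simp
  qed
  then have "vec.dim (g ` {..<Suc k}) = Suc k"
    using independent_if_successively_notin_span[of "Suc k" g] vec.dim_eq_card_independent by metis
  moreover have "g ` {..<Suc k} = (\<lambda>i. (F ^^ i) u) ` {..k}"
  proof -
    have "i \<in> (\<lambda>i. k - i) ` {..<Suc k}" if "i \<le> k" for i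
      using that by (intro image_eqI[of _ _ "k - i"]) auto
    then have "(\<lambda>i. k - i) ` {..<Suc k} = {..k}"
      by auto
    moreover have "g ` {..<Suc k} = (\<lambda>i. (F ^^ i) u) ` (\<lambda>i. k - i) ` {..<Suc k}"
      by (simp add: image_image g_def)
    ultimately show ?thesis by simp
  qed
  ultimately show ?thesis by simp
qed

section \<open>Highest weight theory for sl(2)\<close>

text \<open>Together \<open>FE\<close> and \<open>EF\<close> say that \<open>[E, F] = 2 H\<close>
  and that the Casimir operator \<open>F E + H^2 + H\<close> is the scalar \<open>c\<close>. The
  highest weight turns out to be \<open>m = k/2\<close> with \<open>k + 1\<close> the dimension, so
  \<open>4 c = 4 m (m + 1) = (k + 1)^2 - 1\<close>.\<close>

lemma sl2_irreducible_casimir: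
  fixes E F H :: "complex^'n \<Rightarrow> complex^'n"
  assumes E: "Vector_Spaces.linear (*s) (*s) E"
    and F: "Vector_Spaces.linear (*s) (*s) F"
    and H: "Vector_Spaces.linear (*s) (*s) H"
    and HE: "\<And>v. H (E v) = E (H v) + 1 *s E v"
    and HF: "\<And>v. H (F v) = F (H v) + (-1) *s F v"
    and FE: "\<And>v. F (E v) = c *s v - H (H v) - H v"
    and EF: "\<And>v. E (F v) = c *s v - H (H v) + H v"
    and irreducible: "\<And>W. vec.subspace W \<Longrightarrow>
      (\<And>v. v \<in> W \<Longrightarrow> E v \<in> W \<and> F v \<in> W \<and> H v \<in> W) \<Longrightarrow> W = {0} \<or> W = UNIV"
  shows "4 * c = (of_nat CARD('n))\<^sup>2 - 1"
proof -
  obtain w l where w: "w \<noteq> 0" "H w = l *s w"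
    using eigenvector_exists[OF H] by blast
  obtain r where r: "(E ^^ Suc r) w = 0" "\<And>i. i \<le> r \<Longrightarrow> (E ^^ i) w \<noteq> 0"
    using least_funpow_vanishing[OF funpow_ladder_vanishes[OF H E HE w(2)] w(1)] by auto
  \<comment> \<open>Raising \<open>w\<close> as far as possible gives a highest weight vector, of
    weight \<open>l + r\<close>.\<close>
  define u where "u = (E ^^ r) w"
  define m where "m = l + of_nat r"
  have u: "u \<noteq> 0" "E u = 0" "H u = m *s u"
    using r funpow_ladder[OF H E HE w(2), of r] by (auto simp: u_def m_def)
  obtain k where k: "(F ^^ Suc k) u = 0" "\<And>i. i \<le> k \<Longrightarrow> (F ^^ i) u \<noteq> 0"
    using least_funpow_vanishing[OF funpow_ladder_vanishes[OF H F HF u(3)] u(1)] by auto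
  have Hf: "H ((F ^^ i) u) = (m - of_nat i) *s (F ^^ i) u" for i
    using funpow_ladder[OF H F HF u(3), of i] by simp
  \<comment> \<open>Because the Casimir operator is scalar, \<open>E\<close> undoes a step of
    \<open>F\<close> up to a factor, without induction along the chain.\<close>
  have EFf: "E (F ((F ^^ i) u)) = (c - (m - of_nat i)\<^sup>2 + (m - of_nat i)) *s (F ^^ i) u" for i
    unfolding EF Hf vec.linear_scale[OF H]
    by (simp add: vec_eq_iff algebra_simps power2_eq_square)
  let ?B = "(\<lambda>i. (F ^^ i) u) ` {..k}"
  have mem: "(F ^^ i) u \<in> vec.span ?B" if "i \<le> k" for i
    using that by (intro vec.span_base) auto
  have "E b \<in> vec.span ?B" "F b \<in> vec.span ?B" "H b \<in> vec.span ?B" if "b \<in> ?B" for b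
  proof -
    obtain i where i: "i \<le> k" "b = (F ^^ i) u" using \<open>b \<in> ?B\<close> by blast
    show "E b \<in> vec.span ?B"
    proof (cases i)
      case 0
      then show ?thesis using i u(2) by (simp add: vec.span_zero)
    next
      case (Suc n)
      have "E b = (c - (m - of_nat n)\<^sup>2 + (m - of_nat n)) *s (F ^^ n) u"
        unfolding i(2) Suc using EFf[of n] by simp
      moreover have "(F ^^ n) u \<in> vec.span ?B"
        using mem[of n] i Suc by simp
      ultimately show ?thesis
        by (metis vec.span_scale)
    qed
    show "F b \<in> vec.span ?B"
    proof (cases "i = k")
      case True
      then show ?thesis using i k(1) by (simp add: vec.span_zero)
    next
      case False
      then show ?thesis using i mem[of "Suc i"] by simp
    qed
    show "H b \<in> vec.span ?B"
      unfolding i(2) Hf using mem[OF i(1)] by (rule vec.span_scale)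
  qed
  then have "vec.span ?B = {0} \<or> vec.span ?B = UNIV"
    by (intro irreducible vec.subspace_span conjI)
      (auto intro: linear_image_span_subset E F H)
  moreover have "u \<in> vec.span ?B" using mem[of 0] by simp
  ultimately have "vec.span ?B = UNIV" using u(1) by blast
  then have N: "CARD('n) = Suc k"
    using dim_nilpotent_orbit[OF F k(1) k(2)[of k]] vec.dim_span[of ?B]
    by (simp add: vec_dim_card del: vec.dim_UNIV)
  \<comment> \<open>Top of the chain: \<open>E u = 0\<close> makes the left side of
    \<open>FE\<close> vanish.\<close>
  have "(c - m\<^sup>2 - m) *s u = 0"
    using FE[of u] unfolding u vec.linear_0[OF F] vec.linear_scale[OF H]
    by (simp only: vec.scale_left_distrib vec.scale_left_diff_distrib power2_eq_square vec.scale_scale)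
  then have top: "c - m\<^sup>2 - m = 0"
    using u(1) by (metis vec.scale_eq_0_iff)
  \<comment> \<open>Bottom of the chain: \<open>F\<close> kills the last vector, so the left side of
    \<open>EF\<close> vanishes.\<close>
  have "(c - (m - of_nat k)\<^sup>2 + (m - of_nat k)) *s (F ^^ k) u = 0"
    using EFf[of k] k(1) by (simp add: vec.linear_0[OF E])
  then have bottom: "c - (m - of_nat k)\<^sup>2 + (m - of_nat k) = 0"
    using k(2)[of k] by (metis order_refl vec.scale_eq_0_iff)
  \<comment> \<open>Subtracting the two expressions for \<open>c\<close> leaves a product whose
    first factor is nonzero.\<close>
  have "(of_nat k + 1) * (2 * m - of_nat k) = 0"
    using top bottom by (simp add: algebra_simps power2_eq_square)
  moreover have "of_nat k + 1 \<noteq> (0::complex)"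
    by (metis of_nat_Suc of_nat_neq_0 add.commute)
  ultimately have "of_nat k = 2 * m" by simp
  then show ?thesis
    using top unfolding N by (simp add: algebra_simps power2_eq_square)
qed

section \<open>From the Nambu relations to sl(2)\<close>

lemma smult_matrix_vector_mult: "(c *\<^sub>m A) *v x = c *s (A *v x)"
  by (simp add: smult_matrix_def matrix_vector_mult_def vec_eq_iff sum_distrib_left mult.assoc)

lemma nambu_commutator_vector_mult:
  "nambu_commutator A B C *v x =
    A *v (B *v (C *v x)) + B *v (C *v (A *v x)) + C *v (A *v (B *v x))
    - B *v (A *v (C *v x)) - A *v (C *v (B *v x)) - C *v (B *v (A *v x))"
  by (simp add: nambu_commutator_def matrix_vector_mult_add_rdistrib matrix_vector_mult_diff_rdistrib
      matrix_vector_mul_assoc matrix_mul_assoc)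

lemma nambu_A4_relationsD:
  assumes "nambu_A4_relations T" and "a \<in> {1..4}" "b \<in> {1..4}" "c \<in> {1..4}"
  shows "nambu_commutator (T a) (T b) (T c) *v x =
    \<i> *s (of_int (levi_civita4 a b c 1) *s (T 1 *v x) + of_int (levi_civita4 a b c 2) *s (T 2 *v x)
      + of_int (levi_civita4 a b c 3) *s (T 3 *v x) + of_int (levi_civita4 a b c 4) *s (T 4 *v x))"
proof -
  have "{1..4::nat} = {1, 2, 3, 4}"
    by auto
  moreover have "nambu_commutator (T a) (T b) (T c) =
      \<i> *\<^sub>m (\<Sum>d=1..4. of_int (levi_civita4 a b c d) *\<^sub>m T d)"
    using assms unfolding nambu_A4_relations_def by blast
  ultimately show ?thesis
    by (simp add: smult_matrix_vector_mult matrix_vector_mult_add_rdistrib add.assoc)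
qed

theorem mainTheorem1:
  fixes j :: real
    and T :: "nat \<Rightarrow> complex^'n^'n"
    and t4 :: complex
  assumes "j \<in> range (\<lambda>k::nat. real k / 2)"
    and "real CARD('n) = 2 * j + 1"
    and "nambu_A4_relations T"
    and "T 4 = t4 *\<^sub>m mat 1"
    and "t4 \<noteq> 0"
    and "acts_irreducibly {T 1, T 2, T 3}"
  shows "t4 ^ 4 = - complex_of_real (j * (j + 1)) \<and>
         \<not> (\<forall>a\<in>{1..4}. hermitian_matrix (T a))"
proof -
  define A B C where ABC: "A = (\<lambda>x. T 1 *v x)" "B = (\<lambda>x. T 2 *v x)" "C = (\<lambda>x. T 3 *v x)"
  have linear: "Vector_Spaces.linear (*s) (*s) A" "Vector_Spaces.linear (*s) (*s) B"
    "Vector_Spaces.linear (*s) (*s) C"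
    by (simp_all add: ABC)
  note lin = linear[THEN vec.linear_add] linear[THEN vec.linear_scale] linear[THEN vec.linear_diff]
    linear[THEN vec.linear_neg]
  \<comment> \<open>The variant with \<open>Suc 0\<close> is there because the simplifier rewrites
    the index \<open>1\<close> to it.\<close>
  have app: "T 1 *v x = A x" "T (Suc 0) *v x = A x" "T 2 *v x = B x" "T 3 *v x = C x" for x
    by (simp_all add: ABC)
  have T4: "T 4 *v x = t4 *s x" for x
    by (simp add: assms(4) smult_matrix_vector_mult)
  \<comment> \<open>A scalar third entry collapses the Nambu bracket to \<open>t4\<close> times an
    ordinary commutator; the minus signs are those of the odd permutations 1243, 2341 and
    3142.\<close>
  have AB: "t4 *s A (B x) - t4 *s B (A x) = - \<i> *s C x"
    and BC: "t4 *s B (C x) - t4 *s C (B x) = - \<i> *s A x"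
    and CA: "t4 *s C (A x) - t4 *s A (C x) = - \<i> *s B x" for x
    using nambu_A4_relationsD[OF assms(3), of 1 2 4 x] nambu_A4_relationsD[OF assms(3), of 2 3 4 x]
      nambu_A4_relationsD[OF assms(3), of 3 1 4 x]
    by (simp_all add: nambu_commutator_vector_mult T4 levi_civita4_def app lin)
  have Casimir: "A (A x) + B (B x) + C (C x) = - (t4\<^sup>2) *s x" for x
  proof -
    have "A (B (C x)) + B (C (A x)) + C (A (B x)) - B (A (C x)) - A (C (B x)) - C (B (A x)) =
      \<i> *s (t4 *s x)"
      using nambu_A4_relationsD[OF assms(3), of 1 2 3 x]
      by (simp add: nambu_commutator_vector_mult T4 levi_civita4_def app)
    \<comment> \<open>Grouping the six terms as \<open>A [B, C] + B [C, A] + C [A, B]\<close> lets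
      the commutators turn the bracket into a sum of squares.\<close>
    moreover have "A (t4 *s B (C x) - t4 *s C (B x)) + B (t4 *s C (A x) - t4 *s A (C x))
        + C (t4 *s A (B x) - t4 *s B (A x)) =
        t4 *s (A (B (C x)) + B (C (A x)) + C (A (B x)) - B (A (C x)) - A (C (B x)) - C (B (A x)))"
      by (simp add: lin vec_eq_iff algebra_simps)
    ultimately have "- \<i> *s (A (A x) + B (B x) + C (C x)) = t4 *s (\<i> *s (t4 *s x))"
      unfolding AB BC CA by (simp add: lin vec.scale_right_distrib)
    then have "\<i> *s (- \<i> *s (A (A x) + B (B x) + C (C x))) = \<i> *s (t4 *s (\<i> *s (t4 *s x)))"
      by simp
    then show ?thesis
      by (simp add: power2_eq_square vec_eq_iff mult.left_commute[of t4 \<i>])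
  qed
  \<comment> \<open>With \<open>S_a = - t4 T_a\<close> these are \<open>S_1 + i S_2\<close>,
    \<open>S_1 - i S_2\<close> and \<open>S_3\<close>.\<close>
  define E F H where EFH: "E = (\<lambda>x. - t4 *s (A x + \<i> *s B x))" "F = (\<lambda>x. - t4 *s (A x - \<i> *s B x))"
    "H = (\<lambda>x. - t4 *s C x)"
  \<comment> \<open>Rescaling multiplies the Casimir value \<open>- t4^2\<close> by another
    \<open>t4^2\<close>, so \<open>c = - t4^4\<close>.\<close>
  have "4 * (- (t4 ^ 4)) = (of_nat CARD('n))\<^sup>2 - (1::complex)"
  proof (rule sl2_irreducible_casimir)
    show "Vector_Spaces.linear (*s) (*s) E" "Vector_Spaces.linear (*s) (*s) F" "Vector_Spaces.linear (*s) (*s) H"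
      unfolding EFH
      by (intro vec.linear_compose_add vec.linear_compose_sub vec.linear_compose_scale_right linear)+
  next
    fix v
    \<comment> \<open>In components these become polynomial identities over the complex numbers,
      where \<open>algebra\<close> applies once \<open>i^2 = -1\<close> is supplied.\<close>
    have "H (E v) $ i = (E (H v) + 1 *s E v) $ i" "H (F v) $ i = (F (H v) + (-1) *s F v) $ i"
      "F (E v) $ i = (- (t4 ^ 4) *s v - H (H v) - H v) $ i"
      "E (F v) $ i = (- (t4 ^ 4) *s v - H (H v) + H v) $ i" for i
    proof -
      note rels = AB[of v, unfolded vec_eq_iff] BC[of v, unfolded vec_eq_iff]
        CA[of v, unfolded vec_eq_iff] Casimir[of v, unfolded vec_eq_iff]
      have rel: "t4 * A (B v) $ i - t4 * B (A v) $ i = - \<i> * C v $ i"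
        "t4 * B (C v) $ i - t4 * C (B v) $ i = - \<i> * A v $ i"
        "t4 * C (A v) $ i - t4 * A (C v) $ i = - \<i> * B v $ i"
        "A (A v) $ i + B (B v) $ i + C (C v) $ i = - (t4\<^sup>2) * v $ i" "\<i> * \<i> = -1"
        using rels[THEN spec, of i] by simp_all
      note component = vector_add_component vector_minus_component vector_smult_component
      show "H (E v) $ i = (E (H v) + 1 *s E v) $ i"
        unfolding EFH lin component using rel by algebra
      show "H (F v) $ i = (F (H v) + (-1) *s F v) $ i"
        unfolding EFH lin component using rel by algebra
      show "F (E v) $ i = (- (t4 ^ 4) *s v - H (H v) - H v) $ i"
        unfolding EFH lin component using rel by algebra
      show "E (F v) $ i = (- (t4 ^ 4) *s v - H (H v) + H v) $ i"
        unfolding EFH lin component using rel by algebra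
    qed
    then show "H (E v) = E (H v) + 1 *s E v" "H (F v) = F (H v) + (-1) *s F v"
      "F (E v) = - (t4 ^ 4) *s v - H (H v) - H v" "E (F v) = - (t4 ^ 4) *s v - H (H v) + H v"
      by (simp_all only: vec_eq_iff simp_thms)
  next
    fix W assume W: "vec.subspace W" "\<And>v. v \<in> W \<Longrightarrow> E v \<in> W \<and> F v \<in> W \<and> H v \<in> W"
    have "A v \<in> W" "B v \<in> W" "C v \<in> W" if v: "v \<in> W" for v
    proof -
      \<comment> \<open>As \<open>t4\<close> is nonzero, the change of basis to \<open>E\<close>,
        \<open>F\<close>, \<open>H\<close> inverts, so irreducibility carries over.\<close>
      have eqs: "A v = (- 1 / (2 * t4)) *s (E v + F v)" "B v = (\<i> / (2 * t4)) *s (E v - F v)"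
        "C v = (- 1 / t4) *s H v"
        using assms(5) by (simp_all add: EFH vec_eq_iff field_simps)
      have "E v \<in> W" "F v \<in> W" "H v \<in> W"
        using W(2) v by simp_all
      then show "A v \<in> W" "B v \<in> W" "C v \<in> W"
        by (simp_all only: eqs vec.subspace_scale vec.subspace_add vec.subspace_diff W(1))
    qed
    then have "\<forall>M\<in>{T 1, T 2, T 3}. \<forall>v\<in>W. M *v v \<in> W"
      by (simp add: ABC)
    with W(1) show "W = {0} \<or> W = UNIV"
      by (intro assms(6)[unfolded acts_irreducibly_def, THEN spec, THEN mp] conjI)
  qed
  moreover have "(of_nat CARD('n) :: complex) = 2 * of_real j + 1"
    by (metis assms(2) of_real_of_nat_eq of_real_add of_real_mult of_real_1 of_real_numeral)
  ultimately have "4 * t4 ^ 4 = 4 * (- complex_of_real (j * (j + 1)))"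
    unfolding of_real_mult of_real_add of_real_1 by algebra
  then have t4: "t4 ^ 4 = - complex_of_real (j * (j + 1))"
    by (metis mult_left_cancel zero_neq_numeral)
  moreover have "\<not> hermitian_matrix (T 4)"
  proof
    assume "hermitian_matrix (T 4)"
    then have "cnj t4 = t4"
      unfolding assms(4) hermitian_matrix_def smult_matrix_def mat_def vec_eq_iff
      by (auto split: if_splits)
    then obtain r where r: "t4 = of_real r"
      by (metis Reals_cnj_iff Reals_cases)
    have "j \<ge> 0"
      using assms(1) by auto
    have "complex_of_real (r ^ 4) = complex_of_real (- (j * (j + 1)))"
      using t4 by (simp add: r)
    then have "r ^ 4 = - (j * (j + 1))"
      by (simp only: of_real_eq_iff)
    with \<open>j \<ge> 0\<close> have "r ^ 4 \<le> 0"
      by simp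
    \<comment> \<open>The weak inequality suffices, also for \<open>j = 0\<close>: an even power of
      a real that is at most zero forces \<open>r = 0\<close>.\<close>
    with assms(5) show False
      by (simp add: r power_le_zero_eq)
  qed
  ultimately show ?thesis
    by auto
qed

end
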